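(* Let $R$ be a finite ring, let $r\in R$, and let $x$ be any vertex of the graph $\Gamma_R^r$ (that is, any $x\in R$). Then: (a) if $r\neq 0$ and $2r=0$, then $$\deg(x)=\begin{cases}|R|-1, & \text{if } T_{x,r}=\emptyset,\\ |R|-|C_R(x)|-1, & \text{otherwise};\end{cases}$$ (b) if $r\neq 0$ and $2r\neq 0$, then $$\deg(x)=\begin{cases}|R|-1, & \text{if } T_{x,r}=\emptyset,\\ |R|-2|C_R(x)|-1, & \text{otherwise}.\end{cases}$$
   Context: Rings are associative and not assumed to have a unity. $[x,y]:=xy-yx$. $C_R(x):=\{y\in R: xy=yx\}$. For $x,r\in R$, $T_{x,r}:=\{y\in R:[x,y]=r\}$. The $r$-noncommuting graph $\Gamma_R^r$ is the simple undirected graph with vertex set $R$ in which two distinct vertices $x,y$ are adjacent if and only if $[x,y]\neq r$ and $[x,y]\neq -r$. $\deg(x)$ is the degree of $x$ in $\Gamma_R^r$. *)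

theory Defs
  imports Main
begin

text \<open>
  The type class \<^class>\<open>ring\<close> is that of associative rings, not assumed to be commutative
  or to have a unity.
\<close>

definition commutator :: "'a::ring \<Rightarrow> 'a \<Rightarrow> 'a" where
  "commutator x y = x * y - y * x"

definition ring_centralizer :: "'a::ring \<Rightarrow> 'a set" where
  "ring_centralizer x = {y. x * y = y * x}"

definition T_set :: "'a::ring \<Rightarrow> 'a \<Rightarrow> 'a set" where
  "T_set x r = {y. commutator x y = r}"

text \<open>
  A simple undirected graph is given by a vertex set and a symmetric irreflexive adjacency
  relation; the degree of a vertex is its number of neighbours (meaningful for finite graphs).
\<close>

definition simple_graph :: "'v set \<Rightarrow> ('v \<Rightarrow> 'v \<Rightarrow> bool) \<Rightarrow> bool" where
  "simple_graph V adj \<longleftrightarrow>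
     (\<forall>u v. adj u v \<longrightarrow> u \<in> V \<and> v \<in> V) \<and>
     (\<forall>u v. adj u v \<longrightarrow> adj v u) \<and> (\<forall>u. \<not> adj u u)"

definition degree :: "'v set \<Rightarrow> ('v \<Rightarrow> 'v \<Rightarrow> bool) \<Rightarrow> 'v \<Rightarrow> nat" where
  "degree V adj v = card {w \<in> V. adj v w}"

definition noncomm_adj :: "'a::ring \<Rightarrow> 'a \<Rightarrow> 'a \<Rightarrow> bool" where
  "noncomm_adj r x y \<longleftrightarrow> x \<noteq> y \<and> commutator x y \<noteq> r \<and> commutator x y \<noteq> - r"

lemma simple_graph_noncomm: "simple_graph UNIV (noncomm_adj r)"
proof -
  have "commutator v u = - commutator u v" for u v :: 'a
    by (simp add: commutator_def)
  then show ?thesis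
    unfolding simple_graph_def noncomm_adj_def by (metis UNIV_I minus_minus)
qed

end

theory Submission
  imports Defs
begin

text \<open>The map y \<mapsto> [x,y] is additive with kernel C_R(x), so each nonempty fibre T_{x,r}
  is a coset of C_R(x) and has its size (\<open>T_set_eq_translate_centralizer\<close>,
  \<open>card_T_set\<close>). The vertices not adjacent to x are x itself and the members of the
  fibres over r and -r (\<open>degree_noncomm_adj\<close>). These two fibres coincide when 2r = 0;
  otherwise they are disjoint and negation matches them (\<open>T_set_uminus\<close>). Hence 0, 1 or
  2 copies of |C_R(x)| are lost.\<close>

lemma T_set_eq_translate_centralizer:
  fixes r x y :: "'a::ring"
  assumes "y \<in> T_set x r"
  shows "T_set x r = (+) y ` ring_centralizer x"
proof (intro equalityI subsetI)
  fix z assume "z \<in> T_set x r"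
  with assms have "x * (z - y) = (z - y) * x"
    by (simp add: T_set_def commutator_def algebra_simps)
  then have "z - y \<in> ring_centralizer x"
    by (simp add: ring_centralizer_def)
  then show "z \<in> (+) y ` ring_centralizer x"
    by (rule rev_image_eqI) simp
next
  fix z assume "z \<in> (+) y ` ring_centralizer x"
  with assms show "z \<in> T_set x r"
    by (auto simp: T_set_def commutator_def ring_centralizer_def algebra_simps)
qed

lemma card_T_set:
  assumes "T_set x r \<noteq> {}"
  shows "card (T_set x r) = card (ring_centralizer x)"
proof -
  obtain y where "y \<in> T_set x r"
    using assms by blast
  then have "T_set x r = (+) y ` ring_centralizer x"
    by (rule T_set_eq_translate_centralizer)
  then show ?thesis
    by (simp add: card_image)
qed

text \<open>Additivity of y \<mapsto> [x,y] turns negation of y into negation of the value. This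
  makes the two fibres equinumerous, in particular empty together.\<close>

lemma T_set_uminus: "T_set x (- r) = uminus ` T_set x r"
proof -
  have "commutator x (- y) = - commutator x y" for y
    by (simp add: commutator_def)
  then have "y \<in> T_set x (- r) \<longleftrightarrow> - y \<in> T_set x r" for y
    by (metis (mono_tags) T_set_def mem_Collect_eq minus_minus)
  then show ?thesis
    by (auto intro: rev_image_eqI[of "- _"])
qed

text \<open>Since [x,x] = 0 and r \<noteq> 0, x lies in neither fibre, so it is counted separately;
  this is the final -1.\<close>

lemma degree_noncomm_adj:
  fixes r x :: "'a::{ring,finite}"
  assumes "r \<noteq> 0"
  shows "int (degree UNIV (noncomm_adj r) x) =
    int (card (UNIV :: 'a set)) - int (card (T_set x r \<union> T_set x (- r))) - 1"
proof -
  let ?N = "insert x (T_set x r \<union> T_set x (- r))"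
  have "{w \<in> UNIV. noncomm_adj r x w} = - ?N"
    by (auto simp: noncomm_adj_def T_set_def)
  moreover have "card ?N = Suc (card (T_set x r \<union> T_set x (- r)))"
    using assms by (intro card_insert_disjoint) (auto simp: T_set_def commutator_def)
  \<comment> \<open>Ensures that the subtraction in \<open>nat\<close> is not truncated, so it
    carries over to \<open>int\<close>.\<close>
  moreover have "card ?N \<le> card (UNIV :: 'a set)"
    by (simp add: card_mono)
  ultimately show ?thesis
    by (simp add: degree_def Compl_eq_Diff_UNIV card_Diff_subset of_nat_diff)
qed

theorem corollary2p2:
  fixes r x :: "'a::{ring,finite}"
  shows "(r \<noteq> 0 \<and> r + r = 0 \<longrightarrow>
      int (degree (UNIV :: 'a set) (noncomm_adj r) x) =
        (if T_set x r = {} then int (card (UNIV :: 'a set)) - 1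
         else int (card (UNIV :: 'a set)) - int (card (ring_centralizer x)) - 1))
    \<and> (r \<noteq> 0 \<and> r + r \<noteq> 0 \<longrightarrow>
      int (degree (UNIV :: 'a set) (noncomm_adj r) x) =
        (if T_set x r = {} then int (card (UNIV :: 'a set)) - 1
         else int (card (UNIV :: 'a set)) - 2 * int (card (ring_centralizer x)) - 1))"
proof (intro conjI impI; elim conjE)
  assume "r \<noteq> 0" "r + r = 0"
  \<comment> \<open>The union of the two fibres collapses to \<open>T_set x r\<close>.\<close>
  moreover from \<open>r + r = 0\<close> have "- r = r"
    by (rule minus_unique)
  ultimately show "int (degree UNIV (noncomm_adj r) x) =
      (if T_set x r = {} then int (card (UNIV :: 'a set)) - 1
       else int (card (UNIV :: 'a set)) - int (card (ring_centralizer x)) - 1)"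
    by (simp add: degree_noncomm_adj card_T_set)
next
  assume "r \<noteq> 0" "r + r \<noteq> 0"
  \<comment> \<open>A common element would force r = -r, that is 2r = 0.\<close>
  then have "T_set x r \<inter> T_set x (- r) = {}"
    by (auto simp: T_set_def eq_neg_iff_add_eq_0)
  then have "card (T_set x r \<union> T_set x (- r)) = card (T_set x r) + card (T_set x (- r))"
    by (simp add: card_Un_disjoint)
  also have "card (T_set x (- r)) = card (T_set x r)"
    by (simp add: T_set_uminus card_image)
  finally show "int (degree UNIV (noncomm_adj r) x) =
      (if T_set x r = {} then int (card (UNIV :: 'a set)) - 1
       else int (card (UNIV :: 'a set)) - 2 * int (card (ring_centralizer x)) - 1)"
    using \<open>r \<noteq> 0\<close> by (simp add: degree_noncomm_adj card_T_set)
qed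

end
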